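(* For every positive integer $n$, $$\operatorname{bdim}(\mathcal{B}_n) \geq \frac{n}{\log(n+1)}.$$
   Context: Here $\log$ denotes the logarithm with base $2$. A poset $P=(X,\leq)$ is a non-empty set $X$ (the ground set) with a reflexive, antisymmetric and transitive relation $\leq$. A linear order is a poset in which any two elements are comparable. For a linear order $L$ and elements $x,y$ of $L$, let $[x \leq_L y] \in \{0,1\}$ be $1$ if $x \leq y$ in $L$ and $0$ otherwise. For linear orders $L_1,\dots,L_d$ on the same ground set, write $[x \leq_{L_i} y]_{i=1}^d = ([x\leq_{L_1} y],\dots,[x \leq_{L_d} y]) \in \{0,1\}^d$. Boolean dimension: let $P$ be a poset with at least two elements and $d$ a nonnegative integer. A pair $((L_1,\dots,L_d),\phi)$, where $L_1,\dots,L_d$ are (arbitrary) linear orders on the ground set of $P$ and $\phi:\{0,1\}^d\to\{0,1\}$ is any map, is a Boolean realizer of $P$ of size $d$ if for every pair of elements $x,y$ of $P$: $x \leq y$ in $P$ if and only if $\phi([x\leq_{L_i} y]_{i=1}^d)=1$. The Boolean dimension $\operatorname{bdim}(P)$ is the minimum size of a Boolean realizer of $P$. For a positive integer $n$, $[n]=\{1,\dots,n\}$ and the Boolean lattice $\mathcal{B}_n$ is the poset of all subsets of $[n]$ ordered by inclusion. *)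

theory Defs
  imports Complex_Main
begin

text \<open>
  A poset is given by its ground set \<open>A\<close> and its order relation \<open>r\<close>, with
  \<open>(x, y) \<in> r\<close> for \<open>x \<le> y\<close> and \<open>partial_order_on A r\<close>.  A tuple
  \<open>(L\<^sub>1, \<dots>, L\<^sub>d)\<close> is a list of length \<open>d\<close>, and \<open>{0,1}\<close> is the type \<^typ>\<open>bool\<close>; so
  \<open>\<phi>\<close> is a function on Boolean lists, of which only the values on lists of length \<open>d\<close>
  matter.
\<close>

definition order_vector :: "'a rel list \<Rightarrow> 'a \<Rightarrow> 'a \<Rightarrow> bool list" where
  "order_vector Ls x y = map (\<lambda>L. (x, y) \<in> L) Ls"

definition boolean_realizer ::
    "'a set \<Rightarrow> 'a rel \<Rightarrow> nat \<Rightarrow> 'a rel list \<Rightarrow> (bool list \<Rightarrow> bool) \<Rightarrow> bool" where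
  "boolean_realizer A r d Ls \<phi> \<longleftrightarrow>
     length Ls = d \<and>
     (\<forall>L \<in> set Ls. linear_order_on A L) \<and>
     (\<forall>x \<in> A. \<forall>y \<in> A. (x, y) \<in> r \<longleftrightarrow> \<phi> (order_vector Ls x y))"

text \<open>
  Intended for posets with at least two elements; the value is unspecified if there is
  no Boolean realizer of finite size (which does not happen for finite posets).
\<close>

definition bdim :: "'a set \<Rightarrow> 'a rel \<Rightarrow> nat" where
  "bdim A r = (LEAST d. \<exists>Ls \<phi>. boolean_realizer A r d Ls \<phi>)"

definition boolean_lattice :: "nat \<Rightarrow> nat set rel" where
  "boolean_lattice n = relation_of (\<subseteq>) (Pow {1..n})"

lemma partial_order_on_boolean_lattice:
  "partial_order_on (Pow {1..n}) (boolean_lattice n)"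
  unfolding boolean_lattice_def order_on_defs relation_of_def
  by (auto simp: refl_on_def trans_def antisym_def)

end

theory Submission
  imports Defs "HOL-Library.Nat_Bijection"
begin

text \<open>
  The bound is a counting argument.  Fix a set \<open>C\<close> of elements and compare every element
  \<open>y\<close> with the elements of \<open>C\<close>.  In one linear order \<open>L\<close>, the members of \<open>C\<close> below \<open>y\<close> form an
  initial segment of the chain \<open>C\<close>, so there are at most \<open>card C + 1\<close> possible outcomes; in
  \<open>d\<close> linear orders together there are at most \<open>(card C + 1) ^ d\<close>.  If the orders belong to a
  Boolean realizer, the outcome decides which members of \<open>C\<close> lie below \<open>y\<close> in the poset.
  Hence at most \<open>(card C + 1) ^ d\<close> subsets of \<open>C\<close> are the intersection of \<open>C\<close> with a principal
  down-set (\<open>boolean_realizer_card_traces\<close>).  In the Boolean lattice, let \<open>C\<close> consist of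
  the \<open>n\<close> singletons: all \<open>2 ^ n\<close> subsets of \<open>C\<close> arise, so \<open>2 ^ n \<le> (n + 1) ^ d\<close>,
  and taking logarithms gives the claim.

  Since the Boolean dimension is defined as a least number, the bound applies to it only
  once some Boolean realizer is known to exist.  One comes from \<open>n\<close> linear extensions
  of inclusion whose intersection is inclusion (\<open>boolean_lattice_realizer\<close>).
\<close>

text \<open>
  Down-sets of a linear order are nested, so their traces on a finite set are determined by
  their cardinalities.
\<close>

lemma linear_order_trace_eq_iff_card_eq:
  assumes L: "linear_order_on A L" and C: "finite C" "C \<subseteq> A" and "y \<in> A" "z \<in> A"
    and card: "card {c \<in> C. (c, y) \<in> L} = card {c \<in> C. (c, z) \<in> L}"
  shows "{c \<in> C. (c, y) \<in> L} = {c \<in> C. (c, z) \<in> L}"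
proof -
  have tr: "trans L" and tot: "total_on A L" and refl: "refl_on A L"
    using L by (auto simp: order_on_defs)
  have "(y, z) \<in> L \<or> (z, y) \<in> L"
    using tot refl \<open>y \<in> A\<close> \<open>z \<in> A\<close> by (cases "y = z") (auto simp: total_on_def refl_on_def)
  then have "{c \<in> C. (c, y) \<in> L} \<subseteq> {c \<in> C. (c, z) \<in> L} \<or>
      {c \<in> C. (c, z) \<in> L} \<subseteq> {c \<in> C. (c, y) \<in> L}"
    using tr by (blast dest: transD)
  then show ?thesis
    using card C(1) by (metis (no_types, lifting) card_subset_eq finite_subset mem_Collect_eq subsetI)
qed

lemma card_image_le_of_determined:
  assumes "finite (h ` A)" and "\<And>x y. x \<in> A \<Longrightarrow> y \<in> A \<Longrightarrow> h x = h y \<Longrightarrow> f x = f y"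
  shows "card (f ` A) \<le> card (h ` A)"
proof -
  have "f ` A \<subseteq> (f \<circ> inv_into A h) ` (h ` A)"
  proof
    fix v assume "v \<in> f ` A"
    then obtain x where x: "x \<in> A" "v = f x" by blast
    have "f (inv_into A h (h x)) = f x"
      using x by (intro assms(2)) (auto intro: inv_into_into f_inv_into_f)
    then show "v \<in> (f \<circ> inv_into A h) ` (h ` A)"
      using x by force
  qed
  then show ?thesis
    using assms(1) surj_card_le by blast
qed

text \<open>
  An element \<open>y\<close> is encoded by the list of its positions relative to \<open>C\<close>, one position for
  each order of the realizer.  This list determines every order vector of a member of \<open>C\<close>
  and \<open>y\<close>, and thus, through \<open>\<phi>\<close>, the trace on \<open>C\<close> of the principal down-set of \<open>y\<close>.
\<close>

lemma boolean_realizer_card_traces: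
  assumes realizer: "boolean_realizer A r d Ls \<phi>" and C: "finite C" "C \<subseteq> A"
  shows "card ((\<lambda>y. {c \<in> C. (c, y) \<in> r}) ` A) \<le> (card C + 1) ^ d"
proof -
  define pos where "pos y = map (\<lambda>L. card {c \<in> C. (c, y) \<in> L}) Ls" for y
  define codes where "codes = {ks. set ks \<subseteq> {..card C} \<and> length ks = d}"
  have len: "length Ls = d" and lin: "\<And>L. L \<in> set Ls \<Longrightarrow> linear_order_on A L"
    and iff: "\<And>x y. x \<in> A \<Longrightarrow> y \<in> A \<Longrightarrow> (x, y) \<in> r \<longleftrightarrow> \<phi> (order_vector Ls x y)"
    using realizer by (auto simp: boolean_realizer_def)
  have codes: "finite codes" "card codes = (card C + 1) ^ d"
    unfolding codes_def by (simp_all add: finite_lists_length_eq card_lists_length_eq)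
  have pos_codes: "pos ` A \<subseteq> codes"
    using C(1) by (auto simp: pos_def codes_def len intro!: card_mono)
  have determined: "{c \<in> C. (c, y) \<in> r} = {c \<in> C. (c, z) \<in> r}"
    if "y \<in> A" "z \<in> A" "pos y = pos z" for y z
  proof -
    have "{c \<in> C. (c, y) \<in> L} = {c \<in> C. (c, z) \<in> L}" if "L \<in> set Ls" for L
      using linear_order_trace_eq_iff_card_eq[OF lin[OF that] C \<open>y \<in> A\<close> \<open>z \<in> A\<close>]
        \<open>pos y = pos z\<close> that by (simp add: pos_def)
    then have "order_vector Ls c y = order_vector Ls c z" if "c \<in> C" for c
      using that by (auto simp: order_vector_def)
    then show ?thesis
      using iff that C(2) by (metis subsetD)
  qed
  have "card ((\<lambda>y. {c \<in> C. (c, y) \<in> r}) ` A) \<le> card (pos ` A)"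
    using determined by (intro card_image_le_of_determined finite_subset[OF pos_codes codes(1)])
  also have "\<dots> \<le> (card C + 1) ^ d"
    using card_mono[OF codes(1) pos_codes] codes(2) by simp
  finally show ?thesis .
qed

lemma boolean_lattice_iff:
  "(S, T) \<in> boolean_lattice n \<longleftrightarrow> S \<subseteq> T \<and> S \<subseteq> {1..n} \<and> T \<subseteq> {1..n}"
  by (auto simp: boolean_lattice_def relation_of_def)

text \<open>
  A set is recovered from the singletons below it, so distinct members of the lattice have
  distinct traces on the set of singletons.
\<close>

lemma boolean_lattice_realizer_size:
  assumes "boolean_realizer (Pow {1..n}) (boolean_lattice n) d Ls \<phi>"
  shows "2 ^ n \<le> (n + 1) ^ d"
proof -
  define C where "C = (\<lambda>j. {j}) ` {1..n}"
  define trace where "trace S = {c \<in> C. (c, S) \<in> boolean_lattice n}" for S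
  have C: "finite C" "C \<subseteq> Pow {1..n}" "card C = n"
    by (auto simp: C_def card_image)
  have "\<Union> (trace S) = S" if "S \<in> Pow {1..n}" for S
    using that by (auto simp: trace_def C_def boolean_lattice_iff)
  then have "inj_on trace (Pow {1..n})"
    by (metis inj_onI)
  then have "2 ^ n = card (trace ` Pow {1..n})"
    by (simp add: card_image card_Pow)
  also have "\<dots> \<le> (n + 1) ^ d"
    using boolean_realizer_card_traces[OF assms C(1,2)] C(3) by (simp add: trace_def[abs_def])
  finally show ?thesis .
qed

text \<open>
  A linear extension of inclusion which compares membership of \<open>j\<close> first, so that it
  puts \<open>S\<close> strictly above \<open>T\<close> whenever \<open>j \<in> S - T\<close>.  Ties are broken by the binary encoding,
  itself monotone and injective on finite sets.
\<close>

definition priority_extension :: "nat \<Rightarrow> nat \<Rightarrow> nat set rel" where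
  "priority_extension n j = {(S, T). S \<subseteq> {1..n} \<and> T \<subseteq> {1..n} \<and> (j \<in> S \<longrightarrow> j \<in> T) \<and>
     ((j \<in> S \<longleftrightarrow> j \<in> T) \<longrightarrow> set_encode S \<le> set_encode T)}"

lemma set_encode_mono: "finite T \<Longrightarrow> S \<subseteq> T \<Longrightarrow> set_encode S \<le> set_encode T"
  unfolding set_encode_def by (rule sum_mono2) auto

lemma linear_order_priority_extension:
  "linear_order_on (Pow {1..n}) (priority_extension n j)"
proof -
  have inj: "S = T" if "S \<subseteq> {1..n}" "T \<subseteq> {1..n}" "set_encode S = set_encode T" for S T
    using that by (meson finite_atLeastAtMost finite_subset set_encode_eq)
  have "antisym (priority_extension n j)"
    by (rule antisymI) (rule inj, auto simp: priority_extension_def)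
  moreover have "trans (priority_extension n j)"
    by (rule transI) (auto simp: priority_extension_def)
  moreover have "total_on (Pow {1..n}) (priority_extension n j)"
    by (auto simp: total_on_def priority_extension_def)
  moreover have "refl_on (Pow {1..n}) (priority_extension n j)"
    by (auto simp: refl_on_def priority_extension_def)
  ultimately show ?thesis
    by (auto simp: order_on_defs priority_extension_def)
qed

text \<open>
  If \<open>S\<close> is not contained in \<open>T\<close>, any \<open>j \<in> S - T\<close> names an extension that reverses the
  pair; thus inclusion is the conjunction of the \<open>n\<close> comparisons.
\<close>

lemma boolean_lattice_realizer:
  "boolean_realizer (Pow {1..n}) (boolean_lattice n) n
     (map (priority_extension n) [1..<Suc n]) (\<lambda>bs. \<forall>b \<in> set bs. b)"
proof -
  have "(S, T) \<in> boolean_lattice n \<longleftrightarrow> (\<forall>j \<in> {1..n}. (S, T) \<in> priority_extension n j)"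
    if "S \<subseteq> {1..n}" "T \<subseteq> {1..n}" for S T
  proof
    assume "(S, T) \<in> boolean_lattice n"
    moreover have "finite T"
      using that(2) finite_subset by blast
    ultimately show "\<forall>j \<in> {1..n}. (S, T) \<in> priority_extension n j"
      using that by (auto simp: boolean_lattice_iff priority_extension_def intro: set_encode_mono)
  next
    assume "\<forall>j \<in> {1..n}. (S, T) \<in> priority_extension n j"
    then have "\<forall>j \<in> {1..n}. j \<in> S \<longrightarrow> j \<in> T"
      by (simp add: priority_extension_def)
    then show "(S, T) \<in> boolean_lattice n"
      using that by (auto simp: boolean_lattice_iff)
  qed
  moreover have "set [1..<Suc n] = {1..n}"
    by auto
  ultimately show ?thesis
    by (simp add: boolean_realizer_def order_vector_def linear_order_priority_extension
        del: upt_Suc One_nat_def)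
qed

theorem corollary8:
  fixes n :: nat
  assumes "n > 0"
  shows "real (bdim (Pow {1..n}) (boolean_lattice n)) \<ge> real n / log 2 (real n + 1)"
proof -
  let ?d = "bdim (Pow {1..n}) (boolean_lattice n)"
  have "\<exists>Ls \<phi>. boolean_realizer (Pow {1..n}) (boolean_lattice n) ?d Ls \<phi>"
    unfolding bdim_def by (rule LeastI_ex) (use boolean_lattice_realizer in blast)
  then have "2 ^ n \<le> (n + 1) ^ ?d"
    using boolean_lattice_realizer_size by blast
  then have "real (2 ^ n) \<le> real ((n + 1) ^ ?d)"
    using of_nat_le_iff by blast
  then have "(2::real) ^ n \<le> (real n + 1) ^ ?d"
    by (simp add: add.commute)
  then have "log 2 (2 ^ n) \<le> log 2 ((real n + 1) ^ ?d)"
    by (subst log_le_cancel_iff) auto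
  then have "real n \<le> real ?d * log 2 (real n + 1)"
    by (simp add: log_nat_power)
  moreover have "log 2 (real n + 1) > 0"
    using assms by simp
  ultimately show ?thesis
    by (simp add: pos_divide_le_eq)
qed

end
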